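(* Let $p$ be a prime number and let $q=p^f$ with $f\ge1$. The valuation polygon of $\Psi_q$, i.e. the graph of $\mu \mapsto v(\Psi_q,\mu)$ for $\mu \in \mathbb{R}$, goes through the origin, has slope $1$ for $\mu > -1$, and has slope $q^j$ for $-j-1 < \mu < -j$, $j = 1,2,\dots$.
   Context: $\Psi_q(T) \in T + T^2\mathbb{Z}[[T]]$ is the unique power series of this form satisfying $\sum_{j=0}^\infty p^{-j}\Psi_q(p^jT)^{q^j} = T$; it is $p$-adically entire. For an entire power series $f = \sum_{i\geq 0} a_iT^i$ with coefficients in $\mathbb{C}_p$ (with valuation $v_p$, $v_p(p)=1$), set $v(f,\mu) := \inf_i (v_p(a_i) + i\mu)$ for $\mu\in\mathbb{R}$; the function $\mu\mapsto v(f,\mu)$ is continuous, piecewise affine and concave, and its graph is the valuation polygon of $f$. *)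

theory Defs
  imports "HOL-Computational_Algebra.Computational_Algebra" "HOL-Library.Extended_Real"
begin

(* The series to which the valuation is applied has coefficients in the rationals, so the
   restriction of v_p from the p-adic complex numbers to the rationals is all that is needed. *)
definition padic_val :: "nat \<Rightarrow> rat \<Rightarrow> ereal" where
  "padic_val p x =
     (if x = 0 then \<infinity>
      else ereal (real (multiplicity (int p) (fst (quotient_of x)))
                - real (multiplicity (int p) (snd (quotient_of x)))))"

(* The function v(f, mu), for an arbitrary valuation v on the coefficients.
   The infimum is taken in the extended reals, so it is meaningful for every f; it may be
   minus infinity if f is not entire. *)
definition ser_val :: "('a::zero \<Rightarrow> ereal) \<Rightarrow> 'a fps \<Rightarrow> real \<Rightarrow> ereal" where
  "ser_val v f \<mu> = (INF i. v (fps_nth f i) + ereal (real i * \<mu>))"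

definition valuation_polygon :: "('a::zero \<Rightarrow> ereal) \<Rightarrow> 'a fps \<Rightarrow> (real \<times> real) set" where
  "valuation_polygon v f = {(\<mu>, y). ser_val v f \<mu> = ereal y}"

(* Over I, the graph G is part of a line of slope s; in particular G has a (finite) point
   above every element of I. *)
definition has_slope_on :: "(real \<times> real) set \<Rightarrow> real \<Rightarrow> real set \<Rightarrow> bool" where
  "has_slope_on G s I \<longleftrightarrow> (\<exists>c. \<forall>\<mu>\<in>I. (\<mu>, s * \<mu> + c) \<in> G)"

(* The first three conditions say that F lies in T + T^2 Z[[T]]; the sum converges in the
   T-adic topology, which is the topology of the type fps. *)
definition is_Psi :: "nat \<Rightarrow> nat \<Rightarrow> rat fps \<Rightarrow> bool" where
  "is_Psi p q F \<longleftrightarrow>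
     fps_nth F 0 = 0 \<and> fps_nth F 1 = 1 \<and> (\<forall>i. fps_nth F i \<in> \<int>) \<and>
     (\<lambda>j. fps_const (1 / of_nat p ^ j) * (F oo (fps_const (of_nat p ^ j) * fps_X)) ^ (q ^ j))
       sums fps_X"

definition Psi :: "nat \<Rightarrow> nat \<Rightarrow> rat fps" where
  "Psi p q = (THE F. is_Psi p q F)"

end

theory Submission imports Defs begin

text \<open>
  Write \<open>\<Psi> = \<Sum> a\<^sub>n T\<^sup>n\<close> and \<open>s\<^sub>l = 1 + q + \<dots> + q\<^bsup>l-1\<^esup>\<close>. Comparing coefficients in the
  functional equation expresses \<open>a\<^sub>n\<close> through the terms \<open>p\<^bsup>j(n-1)\<^esup> [T\<^sup>n] \<Psi>\<^bsup>q^j\<^esup>\<close> with \<open>j \<ge> 1\<close>, which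
  involve only \<open>a\<^sub>m\<close> with \<open>m < n\<close> and have no denominators; so \<open>\<Psi>\<close> exists, is unique and integral.
  Since \<open>s\<^bsub>j+k\<^esub> = s\<^sub>j + q\<^sup>j s\<^sub>k\<close> and \<open>s\<^sub>j \<ge> j\<close>, the same recursion yields \<open>v\<^sub>p(a\<^sub>n) \<ge> l n - s\<^sub>l\<close> for
  all \<open>l\<close> and \<open>n\<close>. For \<open>n = q\<^bsup>l+1\<^esup>\<close> the terms with \<open>j \<ge> 2\<close> are negligible because \<open>s\<^sub>j > j\<close>, and by
  Gauss's lemma the term with \<open>j = 1\<close> has the valuation of \<open>p\<^bsup>n-1\<^esup> a\<^bsub>q^l\<^esub>\<^sup>q\<close>, so equality holds in the
  bound at \<open>n = q\<^sup>l\<close> by induction on \<open>l\<close>. Hence the vertices of the Newton polygon are the points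
  \<open>(q\<^sup>l, l q\<^sup>l - s\<^sub>l)\<close>, and the valuation polygon is its Legendre transform.
\<close>

section \<open>Integral power series and coefficients of their powers\<close>

definition fps_of_int :: "int fps \<Rightarrow> rat fps" where
  "fps_of_int A = Abs_fps (\<lambda>n. of_int (A $ n))"

lemma fps_of_int_nth [simp]: "fps_of_int A $ n = of_int (A $ n)"
  by (simp add: fps_of_int_def)

lemma fps_of_int_mult: "fps_of_int (A * B) = fps_of_int A * fps_of_int B"
  by (rule fps_ext) (simp add: fps_mult_nth)

lemma fps_of_int_power: "fps_of_int (A ^ k) = fps_of_int A ^ k"
proof (induction k)
  case 0
  show ?case by (rule fps_ext) (simp add: fps_one_nth)
qed (simp add: fps_of_int_mult)

lemma fps_power_nth_cong:
  fixes A B :: "'a::comm_ring_1 fps"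
  assumes "\<And>m. m \<le> n \<Longrightarrow> A $ m = B $ m"
  shows "A ^ k $ n = B ^ k $ n"
  using assms
proof (induction k arbitrary: n)
  case (Suc k)
  show ?case
    unfolding power_Suc fps_mult_nth
    by (rule sum.cong) (use Suc in auto)
qed simp

text \<open>In \<open>A * A ^ (k - 1)\<close> the coefficient \<open>A $ n\<close> meets only the
  constant term of \<open>A ^ (k - 1)\<close>, which vanishes because \<open>k \<ge> 2\<close>. This
  makes the recursion for the coefficients of \<open>Psi\<close> well-founded.\<close>

lemma fps_power_nth_cong_less:
  fixes A B :: "'a::comm_ring_1 fps"
  assumes "A $ 0 = 0" "B $ 0 = 0" "k \<ge> 2" "\<And>m. m < n \<Longrightarrow> A $ m = B $ m"
  shows "A ^ k $ n = B ^ k $ n"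
proof -
  obtain l where k: "k = Suc l" "l > 0"
    using assms(3) by (cases k) auto
  have "A ^ l $ 0 = 0" "B ^ l $ 0 = 0"
    using assms k by (auto simp: startsby_zero_power)
  moreover have "A ^ l $ (n - i) = B ^ l $ (n - i)" if "i \<noteq> 0" "i \<le> n" for i
    by (rule fps_power_nth_cong) (use that assms in auto)
  ultimately have "A $ i * A ^ l $ (n - i) = B $ i * B ^ l $ (n - i)" if "i \<le> n" for i
    using that assms by (cases "i = 0"; cases "i = n") auto
  then show ?thesis
    unfolding k power_Suc fps_mult_nth by (intro sum.cong) auto
qed

lemma startsby_zero_power_less:
  assumes "(A :: 'a::comm_ring_1 fps) $ 0 = 0" "n < k"
  shows "A ^ k $ n = 0"
  using startsby_zero_power_prefix[OF assms(1), of k] assms(2) by auto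

section \<open>The coefficient recursion and its unique solution\<close>

text \<open>The functional equation in degree \<open>n\<close>, solved for \<open>A $ n\<close>.
  Stopping at \<open>j = n\<close> loses nothing, since \<open>A ^ (q ^ j)\<close> has order at
  least \<open>q ^ j > n\<close> for \<open>j > n\<close>. The ring is left open because solutions
  are needed over both the integers and the rationals.\<close>

definition solves_Psi_rec :: "nat \<Rightarrow> nat \<Rightarrow> 'a::comm_ring_1 fps \<Rightarrow> bool" where
  "solves_Psi_rec p q A \<longleftrightarrow> A $ 0 = 0 \<and>
     (\<forall>n. A $ n = (if n = 1 then 1 else 0)
       - (\<Sum>j=1..n. of_nat p ^ (j * (n - 1)) * A ^ (q ^ j) $ n))"

lemma solves_Psi_rec_nth:
  assumes "solves_Psi_rec p q A"
  shows "A $ n = (if n = 1 then 1 else 0)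
    - (\<Sum>j=1..n. of_nat p ^ (j * (n - 1)) * A ^ (q ^ j) $ n)"
  using assms unfolding solves_Psi_rec_def by blast

lemma power_ge_two:
  assumes "(q::nat) \<ge> 2" "j \<ge> 1"
  shows "q ^ j \<ge> 2"
  using assms self_le_power[of q j] by simp

lemma less_base_power:
  assumes "(q::nat) \<ge> 2"
  shows "n < q ^ n"
  using less_le_trans[OF less_exp power_mono[OF assms, of n]] by simp

lemma solves_Psi_rec_unique:
  assumes q: "q \<ge> 2" and A: "solves_Psi_rec p q A" and B: "solves_Psi_rec p q B"
  shows "A = B"
proof (rule fps_ext)
  fix n
  show "A $ n = B $ n"
  proof (induction n rule: less_induct)
    case (less n)
    have "A ^ (q ^ j) $ n = B ^ (q ^ j) $ n" if "j \<ge> 1" for j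
      by (rule fps_power_nth_cong_less)
        (use A B less power_ge_two[OF q that] in \<open>auto simp: solves_Psi_rec_def\<close>)
    then have "(\<Sum>j=1..n. of_nat p ^ (j * (n - 1)) * A ^ (q ^ j) $ n)
        = (\<Sum>j=1..n. of_nat p ^ (j * (n - 1)) * B ^ (q ^ j) $ n)"
      by (intro sum.cong) auto
    then show ?case
      unfolding solves_Psi_rec_nth[OF A, of n] solves_Psi_rec_nth[OF B, of n] by (rule arg_cong)
  qed
qed

text \<open>Setting the coefficients from index \<open>n\<close> on to zero guards every recursive
  call by \<open>m < n\<close>, which gives termination.\<close>

fun Psi_coeff :: "nat \<Rightarrow> nat \<Rightarrow> nat \<Rightarrow> int" where
  "Psi_coeff p q n = (if n = 1 then 1 else 0)
     - (\<Sum>j=1..n. of_nat p ^ (j * (n - 1)) *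
          (Abs_fps (\<lambda>m. if m < n then Psi_coeff p q m else 0)) ^ (q ^ j) $ n)"

declare Psi_coeff.simps [simp del]

lemma solves_Psi_rec_exists:
  assumes q: "q \<ge> 2"
  shows "\<exists>A :: int fps. solves_Psi_rec p q A"
proof
  let ?A = "Abs_fps (Psi_coeff p q)"
  have 0: "Psi_coeff p q 0 = 0"
    by (subst Psi_coeff.simps) simp
  have "?A ^ (q ^ j) $ n
      = (Abs_fps (\<lambda>m. if m < n then Psi_coeff p q m else 0)) ^ (q ^ j) $ n" if "j \<ge> 1" for j n
    by (rule fps_power_nth_cong_less) (use 0 power_ge_two[OF q that] in auto)
  then have "(\<Sum>j=1..n. of_nat p ^ (j * (n - 1)) * ?A ^ (q ^ j) $ n)
      = (\<Sum>j=1..n. of_nat p ^ (j * (n - 1)) *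
          (Abs_fps (\<lambda>m. if m < n then Psi_coeff p q m else 0)) ^ (q ^ j) $ n)" for n
    by (intro sum.cong) auto
  then show "solves_Psi_rec p q ?A"
    unfolding solves_Psi_rec_def using 0 Psi_coeff.simps[of p q] by simp
qed

section \<open>From the functional equation to the recursion\<close>

text \<open>Scaling the variable by \<open>p ^ j\<close> multiplies the coefficient of degree
  \<open>n\<close> by \<open>p ^ (j * n)\<close>, and the factor \<open>1 / p ^ j\<close> lowers the
  exponent to \<open>j * (n - 1)\<close>. Convergence is T-adic, and each coefficient of the partial
  sums is eventually constant.\<close>

lemma Psi_series_sums_iff:
  fixes F :: "rat fps"
  assumes p: "p > 0" and q: "q \<ge> 2" and F0: "F $ 0 = 0"
  shows "(\<lambda>j. fps_const (1 / of_nat p ^ j) * (F oo (fps_const (of_nat p ^ j) * fps_X)) ^ (q ^ j))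
       sums fps_X \<longleftrightarrow> solves_Psi_rec p q F"
proof -
  define t :: "nat \<Rightarrow> rat fps" where
    "t j = fps_const (1 / of_nat p ^ j) * (F oo (fps_const (of_nat p ^ j) * fps_X)) ^ (q ^ j)" for j
  have pow: "(F oo (fps_const c * fps_X)) ^ k = Abs_fps (\<lambda>n. c ^ n * F ^ k $ n)" for c k
    using fps_compose_power[of "fps_const c * fps_X" F k] by (simp add: fps_compose_linear)
  have t: "t j $ n = of_nat p ^ (j * (n - 1)) * F ^ (q ^ j) $ n" for j n
  proof (cases "n = 0")
    case True
    \<comment> \<open>Here \<open>n - 1\<close> truncates to \<open>0\<close>, but both sides vanish
      because \<open>F ^ (q ^ j)\<close> has no constant term.\<close>
    then show ?thesis
      using F0 q by (simp add: t_def pow startsby_zero_power)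
  next
    case False
    have "t j $ n = (1 / of_nat p ^ j) * ((of_nat p ^ j) ^ n * F ^ (q ^ j) $ n)"
      by (simp add: t_def pow)
    also have "(of_nat p ^ j) ^ n = (of_nat p :: rat) ^ j * of_nat p ^ (j * (n - 1))"
      using False by (cases n) (simp_all add: power_mult power_add)
    finally show ?thesis using p by simp
  qed
  have tail: "t j $ n = 0" if "j > n" for j n
    using startsby_zero_power_less[OF F0, of n "q ^ j"] less_base_power[OF q, of j] that
    by (simp add: t)
  have partial: "(\<Sum>j<N. t j) $ n = (\<Sum>j\<le>n. t j $ n)" if "N > n" for N n
    unfolding fps_sum_nth
    by (rule sum.mono_neutral_right) (use that tail in auto)
  have "t sums fps_X \<longleftrightarrow> (\<forall>n. (\<Sum>j\<le>n. t j $ n) = (fps_X :: rat fps) $ n)"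
  proof
    assume "t sums fps_X"
    then have "\<forall>n. eventually (\<lambda>N. (\<Sum>j<N. t j) $ n = (fps_X :: rat fps) $ n) sequentially"
      by (simp add: sums_def tendsto_fps_iff)
    then have "eventually (\<lambda>N. (\<Sum>j<N. t j) $ n = (fps_X :: rat fps) $ n \<and> N > n) sequentially" for n
      by (simp add: eventually_conj eventually_gt_at_top)
    then have "\<exists>N. (\<Sum>j<N. t j) $ n = (fps_X :: rat fps) $ n \<and> N > n" for n
      using eventually_happens' trivial_limit_sequentially by blast
    then show "\<forall>n. (\<Sum>j\<le>n. t j $ n) = (fps_X :: rat fps) $ n"
      using partial by metis
  next
    assume *: "\<forall>n. (\<Sum>j\<le>n. t j $ n) = (fps_X :: rat fps) $ n"
    show "t sums fps_X"
      unfolding sums_def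
    proof (rule tendsto_fpsI)
      fix n
      show "eventually (\<lambda>N. (\<Sum>j<N. t j) $ n = (fps_X :: rat fps) $ n) sequentially"
        using eventually_gt_at_top[of n] by eventually_elim (use partial * in simp)
    qed
  qed
  moreover have "(\<Sum>j\<le>n. t j $ n)
      = F $ n + (\<Sum>j=1..n. of_nat p ^ (j * (n - 1)) * F ^ (q ^ j) $ n)" for n
    by (simp add: t atMost_atLeast0 sum.atLeast_Suc_atMost)
  ultimately show ?thesis
    unfolding t_def solves_Psi_rec_def using F0 by (auto simp: eq_diff_eq fps_X_def)
qed

lemma solves_Psi_rec_nth_1:
  assumes q: "q \<ge> 2" and A: "solves_Psi_rec p q A"
  shows "A $ 1 = 1"
proof -
  have "A ^ q $ 1 = 0"
    by (rule startsby_zero_power_less) (use A q in \<open>auto simp: solves_Psi_rec_def\<close>)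
  then show ?thesis
    using solves_Psi_rec_nth[OF A, of 1] by simp
qed

text \<open>The integral solution, read over the rationals, still solves the recursion. Uniqueness
  over the rationals then identifies it with \<open>Psi\<close>, so all valuations can be studied as
  divisibility in the integers.\<close>

lemma Psi_eq:
  assumes p: "p > 0" and q: "q \<ge> 2" and A: "solves_Psi_rec p q A"
  shows "Psi p q = fps_of_int A"
proof -
  have rec: "solves_Psi_rec p q (fps_of_int A)"
    unfolding solves_Psi_rec_def
  proof (intro conjI allI)
    show "fps_of_int A $ 0 = 0" using A by (simp add: solves_Psi_rec_def)
    fix n
    have "A $ n = (if n = 1 then 1 else 0)
       - (\<Sum>j=1..n. of_nat p ^ (j * (n - 1)) * A ^ (q ^ j) $ n)"
      by (rule solves_Psi_rec_nth[OF A])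
    then have "fps_of_int A $ n = of_int ((if n = 1 then 1 else 0)
       - (\<Sum>j=1..n. of_nat p ^ (j * (n - 1)) * A ^ (q ^ j) $ n))"
      by simp
    then show "fps_of_int A $ n = (if n = 1 then 1 else 0)
       - (\<Sum>j=1..n. of_nat p ^ (j * (n - 1)) * fps_of_int A ^ (q ^ j) $ n)"
      by (simp flip: fps_of_int_power)
  qed
  have A0: "A $ 0 = 0" using A by (simp add: solves_Psi_rec_def)
  moreover have "A $ 1 = 1" by (rule solves_Psi_rec_nth_1[OF q A])
  ultimately have "is_Psi p q (fps_of_int A)"
    using Psi_series_sums_iff[OF p q, of "fps_of_int A"] rec by (simp add: is_Psi_def)
  moreover have "F = fps_of_int A" if "is_Psi p q F" for F
    using that rec Psi_series_sums_iff[OF p q, of F] solves_Psi_rec_unique[OF q]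
    by (auto simp: is_Psi_def)
  ultimately show ?thesis
    unfolding Psi_def by (rule the_equality)
qed

section \<open>The sums of powers of \<open>q\<close>\<close>

definition geom_sum :: "nat \<Rightarrow> nat \<Rightarrow> nat" where
  "geom_sum q l = (\<Sum>i<l. q ^ i)"

lemma geom_sum_simps [simp]: "geom_sum q 0 = 0" "geom_sum q (Suc l) = geom_sum q l + q ^ l"
  by (simp_all add: geom_sum_def)

lemma geom_sum_add: "geom_sum q (j + k) = geom_sum q j + q ^ j * geom_sum q k"
  by (induction k) (simp_all add: algebra_simps power_add)

lemma le_geom_sum:
  assumes "q \<ge> 1"
  shows "l \<le> geom_sum q l"
proof (induction l)
  case (Suc l)
  then show ?case using one_le_power[OF assms, of l] by simp
qed simp

lemma less_geom_sum:
  assumes "q \<ge> 2" "l \<ge> 2"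
  shows "l < geom_sum q l"
  using assms(2)
proof (induction l rule: dec_induct)
  case base
  then show ?case using assms(1) by (simp add: numeral_2_eq_2)
next
  case (step l)
  moreover have "q ^ l \<ge> 1" using assms(1) by (intro one_le_power) simp
  ultimately show ?case unfolding geom_sum_simps by linarith
qed

section \<open>Lines below Newton polygons and Gauss's lemma\<close>

text \<open>This says \<open>v\<^sub>p(A\<^sub>n) \<ge> k n - c\<close> for all \<open>n\<close>, with \<open>c\<close> moved across so that no subtraction occurs.\<close>

definition above_line :: "nat \<Rightarrow> nat \<Rightarrow> nat \<Rightarrow> int fps \<Rightarrow> bool" where
  "above_line p k c A \<longleftrightarrow> (\<forall>n. int p ^ (k * n) dvd int p ^ c * A $ n)"

text \<open>Here the line \<open>n \<mapsto> k n - c\<close> supports the Newton polygon, and \<open>M\<close> is the last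
  index at which it touches.\<close>

definition last_on_line :: "nat \<Rightarrow> nat \<Rightarrow> nat \<Rightarrow> nat \<Rightarrow> int fps \<Rightarrow> bool" where
  "last_on_line p k c M A \<longleftrightarrow> above_line p k c A \<and>
     (\<forall>n>M. int p ^ (k * n + 1) dvd int p ^ c * A $ n) \<and>
     \<not> int p ^ (k * M + 1) dvd int p ^ c * A $ M"

lemma above_line_mult:
  assumes "above_line p k c A" "above_line p k d B"
  shows "above_line p k (c + d) (A * B)"
  unfolding above_line_def
proof
  fix n
  have "int p ^ (k * n) dvd int p ^ (c + d) * (A $ i * B $ (n - i))" if "i \<le> n" for i
  proof -
    have "int p ^ (k * i) * int p ^ (k * (n - i)) dvd (int p ^ c * A $ i) * (int p ^ d * B $ (n - i))"
      using assms by (intro mult_dvd_mono) (auto simp: above_line_def)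
    moreover have "k * i + k * (n - i) = k * n"
      using that by (simp flip: distrib_left)
    ultimately show ?thesis
      by (metis mult.assoc mult.left_commute power_add)
  qed
  then show "int p ^ (k * n) dvd int p ^ (c + d) * (A * B) $ n"
    unfolding fps_mult_nth sum_distrib_left by (intro dvd_sum) auto
qed

lemma above_line_power:
  assumes "above_line p k c A"
  shows "above_line p k (N * c) (A ^ N)"
proof (induction N)
  case 0
  show ?case by (simp add: above_line_def fps_one_nth)
next
  case (Suc N)
  then show ?case using above_line_mult[OF assms Suc] by simp
qed

text \<open>Gauss's lemma: a product \<open>A $ i * B $ (n - i)\<close> with \<open>i > M\<close> or
  \<open>n - i > N\<close> gains an extra factor \<open>p\<close>. In degree \<open>M + N\<close>
  the only other product is \<open>A $ M * B $ N\<close>, which gains none because \<open>p\<close>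
  is prime.\<close>

lemma last_on_line_mult:
  assumes p: "prime p" and A: "last_on_line p k c M A" and B: "last_on_line p k d N B"
  shows "last_on_line p k (c + d) (M + N) (A * B)"
proof -
  have strict: "int p ^ (k * n + 1) dvd int p ^ (c + d) * (A $ i * B $ (n - i))"
    if "i \<le> n" "i > M \<or> n - i > N" for i n
  proof -
    have *: "int p ^ (k * i) dvd int p ^ c * A $ i"
        "int p ^ (k * (n - i)) dvd int p ^ d * B $ (n - i)"
        "i > M \<Longrightarrow> int p ^ (k * i + 1) dvd int p ^ c * A $ i"
        "n - i > N \<Longrightarrow> int p ^ (k * (n - i) + 1) dvd int p ^ d * B $ (n - i)"
      using A B by (auto simp: last_on_line_def above_line_def)
    have "int p ^ (k * i + 1) * int p ^ (k * (n - i))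
          dvd (int p ^ c * A $ i) * (int p ^ d * B $ (n - i)) \<or>
        int p ^ (k * i) * int p ^ (k * (n - i) + 1)
          dvd (int p ^ c * A $ i) * (int p ^ d * B $ (n - i))"
      using that(2) * mult_dvd_mono by meson
    moreover have "k * i + k * (n - i) = k * n"
      using that(1) by (simp flip: distrib_left)
    then have "k * i + 1 + k * (n - i) = k * n + 1" "k * i + (k * (n - i) + 1) = k * n + 1"
      by linarith+
    ultimately have "int p ^ (k * n + 1) dvd (int p ^ c * A $ i) * (int p ^ d * B $ (n - i))"
      by (metis power_add)
    then show ?thesis by (simp add: power_add mult_ac)
  qed
  have "int p ^ (k * n + 1) dvd int p ^ (c + d) * (A * B) $ n" if "n > M + N" for n
    unfolding fps_mult_nth sum_distrib_left
    by (rule dvd_sum, rule strict) (use that in auto)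
  moreover have "\<not> int p ^ (k * (M + N) + 1) dvd int p ^ (c + d) * (A * B) $ (M + N)"
  proof
    assume dvd: "int p ^ (k * (M + N) + 1) dvd int p ^ (c + d) * (A * B) $ (M + N)"
    let ?f = "\<lambda>i. int p ^ (c + d) * (A $ i * B $ (M + N - i))"
    have split: "int p ^ (c + d) * (A * B) $ (M + N) = ?f M + (\<Sum>i\<in>{0..M+N}-{M}. ?f i)"
      unfolding fps_mult_nth sum_distrib_left by (rule sum.remove) auto
    have "int p ^ (k * (M + N) + 1) dvd (\<Sum>i\<in>{0..M+N}-{M}. ?f i)"
      by (rule dvd_sum, rule strict) auto
    then have "int p ^ (k * (M + N) + 1) dvd ?f M"
      using dvd unfolding split by (subst (asm) dvd_add_left_iff)
    then have main: "int p ^ (k * (M + N) + 1) dvd (int p ^ c * A $ M) * (int p ^ d * B $ N)"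
      by (simp add: power_add mult_ac)
    obtain a b where a: "int p ^ c * A $ M = int p ^ (k * M) * a"
        and b: "int p ^ d * B $ N = int p ^ (k * N) * b"
      using A B by (meson above_line_def dvdE last_on_line_def)
    have p0: "int p \<noteq> 0" "prime (int p)" using p by auto
    have "\<not> int p dvd a" "\<not> int p dvd b"
      using A B a b p0 unfolding last_on_line_def by auto
    then have "\<not> int p dvd a * b"
      using p0 prime_dvd_multD by blast
    moreover have "int p ^ (k * (M + N)) * int p dvd int p ^ (k * (M + N)) * (a * b)"
      using main unfolding a b by (simp add: power_add distrib_left mult_ac)
    ultimately show False
      using p0 by simp
  qed
  ultimately show ?thesis
    using above_line_mult A B by (simp add: last_on_line_def)
qed

lemma last_on_line_power:
  assumes p: "prime p" and A: "last_on_line p k c M A"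
  shows "last_on_line p k (N * c) (N * M) (A ^ N)"
proof (induction N)
  case 0
  show ?case
    using p by (auto simp: last_on_line_def above_line_def fps_one_nth prime_nat_iff)
next
  case (Suc N)
  then show ?case using last_on_line_mult[OF p A Suc] by simp
qed

section \<open>Valuations of the coefficients of \<open>Psi\<close>\<close>

text \<open>With \<open>l = j + k\<close>, apply the bound of slope \<open>k\<close> to
  \<open>A ^ (q ^ j)\<close> and use \<open>geom_sum_add\<close>. The surplus
  \<open>geom_sum q j - j\<close> is kept because its positivity for \<open>j \<ge> 2\<close>
  isolates the term \<open>j = 1\<close> in \<open>Psi_exact\<close>.\<close>

lemma Psi_rec_term_dvd:
  assumes q: "q \<ge> 2" and A: "\<And>k. above_line p k (geom_sum q k) A"
    and n: "n \<ge> 1" and "j \<le> l"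
  shows "int p ^ (l * n + (geom_sum q j - j))
    dvd int p ^ geom_sum q l * (int p ^ (j * (n - 1)) * A ^ (q ^ j) $ n)"
proof -
  define k where "k = l - j"
  have l: "l = j + k" using assms by (simp add: k_def)
  have "int p ^ (k * n) dvd int p ^ (q ^ j * geom_sum q k) * A ^ (q ^ j) $ n"
    using above_line_power[OF A] by (simp add: above_line_def)
  then have "int p ^ (j * n + (geom_sum q j - j)) * int p ^ (k * n)
      dvd int p ^ (j * n + (geom_sum q j - j)) * (int p ^ (q ^ j * geom_sum q k) * A ^ (q ^ j) $ n)"
    by (rule mult_dvd_mono[OF dvd_refl])
  moreover have "l * n + (geom_sum q j - j) = j * n + (geom_sum q j - j) + k * n"
    by (simp add: l algebra_simps)
  moreover have "geom_sum q l + j * (n - 1) = j * n + (geom_sum q j - j) + q ^ j * geom_sum q k"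
  proof -
    have "j * n = j * (n - 1) + j" using n by (cases n) auto
    moreover have "geom_sum q j \<ge> j" using le_geom_sum q by simp
    ultimately show ?thesis by (simp add: l geom_sum_add)
  qed
  ultimately show ?thesis
    by (metis mult.assoc power_add)
qed

text \<open>Strong induction on \<open>n\<close> for all slopes at once, since the term with index
  \<open>j\<close> at slope \<open>l\<close> calls on slope \<open>l - j\<close>.\<close>

lemma Psi_above_line:
  assumes q: "q \<ge> 2" and A: "solves_Psi_rec p q A"
  shows "above_line p l (geom_sum q l) A"
proof -
  have A0: "A $ 0 = 0" using A by (simp add: solves_Psi_rec_def)
  have "int p ^ (l * n) dvd int p ^ geom_sum q l * A $ n" for l n
  proof (induction n arbitrary: l rule: less_induct)
    case (less n)
    \<comment> \<open>The truncation satisfies the bounds at every index, as required for its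
      powers, while \<open>A $ n\<close> is still unknown.\<close>
    define B where "B = fps_cutoff n A"
    have B: "above_line p k (geom_sum q k) B" for k
      using less by (simp add: above_line_def B_def)
    show ?case
    proof (cases "n = 0")
      case False
      have "int p ^ (l * n) dvd
          int p ^ geom_sum q l * (int p ^ (j * (n - 1)) * A ^ (q ^ j) $ n)" if "j \<ge> 1" for j
      proof (cases "j \<le> l")
        case True
        have "A ^ (q ^ j) $ n = B ^ (q ^ j) $ n"
          by (rule fps_power_nth_cong_less)
            (use A0 power_ge_two[OF q that] in \<open>auto simp: B_def\<close>)
        moreover have "int p ^ (l * n) dvd int p ^ (l * n + (geom_sum q j - j))"
          by (rule le_imp_power_dvd) simp
        ultimately show ?thesis
          using Psi_rec_term_dvd[OF q B, of n j l] \<open>n \<noteq> 0\<close> True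
          by (auto intro: dvd_trans)
      next
        case False
        \<comment> \<open>For \<open>j > l\<close> the explicit powers of \<open>p\<close> suffice,
          whatever the coefficient of \<open>A ^ (q ^ j)\<close> is.\<close>
        have "l * n = l + l * (n - 1)" using \<open>n \<noteq> 0\<close> by (cases n) auto
        also have "\<dots> \<le> geom_sum q l + j * (n - 1)"
          using False le_geom_sum[of q l] q by (intro add_mono mult_right_mono) auto
        finally show ?thesis
          by (metis dvd_mult2 le_imp_power_dvd mult.assoc power_add)
      qed
      then have "int p ^ (l * n) dvd int p ^ geom_sum q l *
          (\<Sum>j=1..n. int p ^ (j * (n - 1)) * A ^ (q ^ j) $ n)"
        unfolding sum_distrib_left by (intro dvd_sum) auto
      moreover have "int p ^ (l * n) dvd int p ^ geom_sum q l * (if n = 1 then 1 else 0)"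
        using le_geom_sum[of q l] q by (auto intro: le_imp_power_dvd)
      ultimately have "int p ^ (l * n) dvd int p ^ geom_sum q l * ((if n = 1 then 1 else 0) -
          (\<Sum>j=1..n. int p ^ (j * (n - 1)) * A ^ (q ^ j) $ n))"
        unfolding right_diff_distrib by (intro dvd_diff)
      also have "(if n = 1 then 1 else 0) -
          (\<Sum>j=1..n. int p ^ (j * (n - 1)) * A ^ (q ^ j) $ n) = A $ n"
        by (simp add: solves_Psi_rec_nth[OF A, of n])
      finally show ?thesis .
    qed (simp add: A0)
  qed
  then show ?thesis by (simp add: above_line_def)
qed

lemma Psi_exact:
  assumes p: "prime p" and q: "q \<ge> 2" and A: "solves_Psi_rec p q A"
  shows "\<not> int p ^ (l * q ^ l + 1) dvd int p ^ geom_sum q l * A $ (q ^ l)"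
proof (induction l)
  case 0
  have "\<not> int p dvd 1" using p by (auto simp: prime_nat_iff)
  then show ?case using solves_Psi_rec_nth_1[OF q A] by simp
next
  case (Suc l)
  note W = Psi_above_line[OF q A]
  have A0: "A $ 0 = 0" using A by (simp add: solves_Psi_rec_def)
  have p0: "int p \<noteq> 0" using p by auto
  \<comment> \<open>Strictness beyond \<open>q ^ l\<close> comes from the line of slope
    \<open>l + 1\<close>: it meets the line of slope \<open>l\<close> at \<open>q ^ l\<close> and
    lies above it afterwards by \<open>n - q ^ l\<close>.\<close>
  have "int p ^ (l * n + 1) dvd int p ^ geom_sum q l * A $ n" if "n > q ^ l" for n
  proof -
    have "int p ^ q ^ l * int p ^ (l * n + 1) dvd int p ^ (Suc l * n)"
      unfolding power_add[symmetric] using that by (intro le_imp_power_dvd) simp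
    also have "\<dots> dvd int p ^ geom_sum q (Suc l) * A $ n"
      using W[of "Suc l"] unfolding above_line_def by blast
    also have "\<dots> = int p ^ q ^ l * (int p ^ geom_sum q l * A $ n)"
      by (simp add: power_add mult_ac)
    finally show ?thesis using p0 by simp
  qed
  then have "last_on_line p l (geom_sum q l) (q ^ l) A"
    using Suc W by (simp add: last_on_line_def)
  then have top: "\<not> int p ^ (l * q ^ Suc l + 1) dvd int p ^ (q * geom_sum q l) * A ^ q $ (q ^ Suc l)"
    using last_on_line_power[OF p, of l "geom_sum q l" "q ^ l" A q] by (simp add: last_on_line_def)
  define n where "n = q ^ Suc l"
  have n2: "n \<ge> 2" unfolding n_def by (rule power_ge_two[OF q]) simp
  define t where "t j = int p ^ geom_sum q (Suc l) * (int p ^ (j * (n - 1)) * A ^ (q ^ j) $ n)" for j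
  have rest: "int p ^ (Suc l * n + 1) dvd t j" if "j \<ge> 2" for j
  proof (cases "j \<le> Suc l")
    case True
    have "int p ^ (Suc l * n + 1) dvd int p ^ (Suc l * n + (geom_sum q j - j))"
      using less_geom_sum[OF q that] by (intro le_imp_power_dvd) auto
    also have "\<dots> dvd t j"
      unfolding t_def using n2 True by (intro Psi_rec_term_dvd[OF q W]) auto
    finally show ?thesis .
  next
    case False
    then have "n < q ^ j"
      unfolding n_def using q by (intro power_strict_increasing) auto
    then show ?thesis
      by (simp add: t_def startsby_zero_power_less[OF A0])
  qed
  have "A $ n = - (\<Sum>j=1..n. int p ^ (j * (n - 1)) * A ^ (q ^ j) $ n)"
    using n2 solves_Psi_rec_nth[OF A, of n] by simp
  moreover have "int p ^ geom_sum q (Suc l) * - (\<Sum>j=1..n. int p ^ (j * (n - 1)) * A ^ (q ^ j) $ n)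
      = - (\<Sum>j=1..n. t j)"
    unfolding t_def mult_minus_right sum_distrib_left ..
  ultimately have "int p ^ geom_sum q (Suc l) * A $ n = - (\<Sum>j=1..n. t j)"
    by metis
  also have "(\<Sum>j=1..n. t j) = t 1 + (\<Sum>j=2..n. t j)"
    using n2 by (simp add: sum.atLeast_Suc_atMost numeral_2_eq_2)
  finally have eq: "int p ^ geom_sum q (Suc l) * A $ n = - (t 1 + (\<Sum>j=2..n. t j))" .
  have "int p ^ (Suc l * n + 1) dvd (\<Sum>j=2..n. t j)"
    by (rule dvd_sum) (use rest in auto)
  moreover have "\<not> int p ^ (Suc l * n + 1) dvd t 1"
  proof
    assume *: "int p ^ (Suc l * n + 1) dvd t 1"
    \<comment> \<open>Since \<open>geom_sum q (Suc l) = 1 + q * geom_sum q l\<close>, a full factor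
      \<open>p ^ n\<close> splits off. It accounts for the step from slope \<open>l\<close> to slope
      \<open>l + 1\<close>.\<close>
    have exponent: "geom_sum q (Suc l) + (n - 1) = n + q * geom_sum q l"
      using n2 geom_sum_add[of q 1 l] by simp
    have "t 1 = int p ^ (geom_sum q (Suc l) + (n - 1)) * A ^ q $ n"
      by (simp add: t_def power_add del: geom_sum_simps)
    also have "\<dots> = int p ^ n * (int p ^ (q * geom_sum q l) * A ^ q $ n)"
      unfolding exponent power_add by (rule mult.assoc)
    finally have t1: "t 1 = int p ^ n * (int p ^ (q * geom_sum q l) * A ^ q $ n)" .
    have "Suc l * n + 1 = n + (l * n + 1)" by simp
    then have "int p ^ n * int p ^ (l * n + 1)
        dvd int p ^ n * (int p ^ (q * geom_sum q l) * A ^ q $ n)"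
      using * unfolding t1 by (simp only: power_add)
    then show False using top p0 by (simp add: n_def)
  qed
  ultimately show ?case
    unfolding n_def[symmetric] eq dvd_minus_iff by (simp add: dvd_add_left_iff)
qed

section \<open>The valuation polygon\<close>

lemma power_dvd_power_mult_iff:
  assumes "prime p" "a \<noteq> 0"
  shows "int p ^ m dvd int p ^ s * a \<longleftrightarrow> m \<le> s + multiplicity (int p) a"
proof -
  have p: "prime (int p)" using assms by simp
  then have "multiplicity (int p) (int p ^ s * a) = s + multiplicity (int p) a"
    using assms by (simp add: prime_elem_multiplicity_mult_distrib)
  then show ?thesis
    using assms p by (subst power_dvd_iff_le_multiplicity) auto
qed

lemma padic_val_of_int:
  "padic_val p (of_int a) = (if a = 0 then \<infinity> else ereal (real (multiplicity (int p) a)))"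
  by (simp add: padic_val_def)

text \<open>On this range of \<open>\<mu>\<close> the infimum is attained at index
  \<open>q ^ j\<close>. The bound of slope \<open>j + 1\<close> controls the indices from
  \<open>q ^ j\<close> on, and that of slope \<open>j\<close> the smaller ones. For
  \<open>j = 0\<close> only index \<open>0\<close> is smaller, and its coefficient is zero, so
  \<open>\<mu>\<close> needs no upper limit.\<close>

lemma ser_val_Psi:
  assumes p: "prime p" and q: "q \<ge> 2"
    and \<mu>: "\<mu> \<ge> - real j - 1" "j = 0 \<or> \<mu> \<le> - real j"
  shows "ser_val (padic_val p) (Psi p q) \<mu>
    = ereal (real q ^ j * \<mu> + (real j * real q ^ j - real (geom_sum q j)))"
proof -
  obtain A :: "int fps" where A: "solves_Psi_rec p q A"
    using solves_Psi_rec_exists[OF q] by blast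
  have A0: "A $ 0 = 0" using A by (simp add: solves_Psi_rec_def)
  have Psi: "Psi p q = fps_of_int A"
    using Psi_eq[OF _ q A] p by (simp add: prime_gt_0_nat)
  let ?y = "real q ^ j * \<mu> + (real j * real q ^ j - real (geom_sum q j))"
  have bound: "real (l * i) \<le> real (geom_sum q l) + real (multiplicity (int p) (A $ i))"
    if "A $ i \<noteq> 0" for l i
    using Psi_above_line[OF q A, of l] power_dvd_power_mult_iff[OF p that]
    unfolding above_line_def by (metis of_nat_add of_nat_mono)
  have lower: "ereal ?y \<le> padic_val p (Psi p q $ i) + ereal (real i * \<mu>)" for i
  proof (cases "A $ i = 0")
    case True
    then show ?thesis by (simp add: Psi padic_val_def)
  next
    case False
    then have "i \<noteq> 0" using A0 by metis
    have "?y \<le> real (multiplicity (int p) (A $ i)) + real i * \<mu>"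
    proof (cases "i \<ge> q ^ j")
      case True
      then have "real (q ^ j) \<le> real i" by (rule of_nat_mono)
      then have "(real j + 1 + \<mu>) * real q ^ j \<le> (real j + 1 + \<mu>) * real i"
        using \<mu> by (intro mult_left_mono) auto
      \<comment> \<open>The slopes \<open>j\<close> and \<open>j + 1\<close> give the same bound at
        \<open>q ^ j\<close>, because \<open>geom_sum q (Suc j)\<close> exceeds
        \<open>geom_sum q j\<close> by exactly \<open>q ^ j\<close>.\<close>
      then show ?thesis using bound[OF False, of "Suc j"] by (simp add: algebra_simps)
    next
      case less: False
      then have "j \<noteq> 0" using \<open>i \<noteq> 0\<close> by (cases j) auto
      have "real i \<le> real (q ^ j)" using less by (intro of_nat_mono) simp
      then have "(real j + \<mu>) * real q ^ j \<le> (real j + \<mu>) * real i"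
        using \<mu> \<open>j \<noteq> 0\<close> by (intro mult_left_mono_neg) auto
      then show ?thesis using bound[OF False, of j] by (simp add: algebra_simps)
    qed
    then show ?thesis using False by (simp add: Psi padic_val_of_int)
  qed
  have nz: "A $ (q ^ j) \<noteq> 0"
    using Psi_exact[OF p q A, of j] by auto
  then have "geom_sum q j + multiplicity (int p) (A $ (q ^ j)) \<le> j * q ^ j"
    using Psi_exact[OF p q A, of j] unfolding power_dvd_power_mult_iff[OF p nz] by simp
  then have "real (geom_sum q j) + real (multiplicity (int p) (A $ (q ^ j))) \<le> real j * real q ^ j"
    by (metis of_nat_add of_nat_mono of_nat_mult of_nat_power)
  then have upper: "padic_val p (Psi p q $ (q ^ j)) + ereal (real (q ^ j) * \<mu>) \<le> ereal ?y"
    using nz by (simp add: Psi padic_val_of_int)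
  show ?thesis
    unfolding ser_val_def
    by (intro antisym INF_greatest lower INF_lower2[where i = "q ^ j"] UNIV_I upper)
qed

theorem theorem3p1:
  fixes p q f :: nat
  assumes "prime p" and "f \<ge> 1" and "q = p ^ f"
  shows "(0, 0) \<in> valuation_polygon (padic_val p) (Psi p q)
    \<and> has_slope_on (valuation_polygon (padic_val p) (Psi p q)) 1 {-1<..}
    \<and> (\<forall>j::nat. j \<ge> 1 \<longrightarrow>
         has_slope_on (valuation_polygon (padic_val p) (Psi p q)) (real q ^ j)
           {- real j - 1<..<- real j})"
proof -
  have q: "q \<ge> 2"
    using assms power_ge_two prime_ge_2_nat by blast
  note polygon = ser_val_Psi[OF assms(1) q]
  have first: "ser_val (padic_val p) (Psi p q) \<mu> = ereal (1 * \<mu> + 0)" if "\<mu> \<ge> -1" for \<mu>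
    using polygon[of 0 \<mu>] that by simp
  have "ser_val (padic_val p) (Psi p q) 0 = ereal 0"
    using first[of 0] by simp
  moreover have "\<forall>\<mu>\<in>{-1<..}. ser_val (padic_val p) (Psi p q) \<mu> = ereal (1 * \<mu> + 0)"
    using first by simp
  moreover have "\<forall>\<mu>\<in>{- real j - 1<..<- real j}. ser_val (padic_val p) (Psi p q) \<mu>
      = ereal (real q ^ j * \<mu> + (real j * real q ^ j - real (geom_sum q j)))" for j
    using polygon[of j] by simp
  ultimately show ?thesis
    unfolding has_slope_on_def valuation_polygon_def mem_Collect_eq prod.case by blast
qed

end
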